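(* Let $U$ be the fixed universal self-delimiting computer and fix an effective encoding, as bit strings, of propositions of the form "the program $q$ is elegant". There is a constant $c$ such that the following holds for every $N$. Let $T$ be a formal theory generated by some $N$-bit program for $U$, and suppose that every theorem of $T$ of the form "$q$ is elegant" is true. Then $T$ contains no theorem of the form "$q$ is elegant" with $|q| > N + c$. That is, an $N$-bit theory cannot prove that any program larger than $N+c$ bits is elegant. The constant $c$ does not depend on $T$ or on $N$.
   Context: A self-delimiting computer $C$ is a deterministic machine that reads its binary program one bit at a time from a one-way read-only tape, with no end-of-program marker, and itself decides when to stop reading. While computing it may display any number (possibly infinitely many) of intermediate outputs, and it may halt with a final output. For a bit string $p$, $C(p)$ is defined with value $x$ if $C$ halts with final output $x$ after having read exactly the bits of $p$. Thus the domain of $C$ is prefix-free. For computations that may never end, $p$ generates a set $S$ on $C$ if $C$ reads exactly the bits of $p$, never requests a further bit, and the set of all outputs displayed over the whole, possibly unending, computation is exactly $S$. Outputs are finite objects such as bit strings. $U$ is a fixed universal self-delimiting computer: for every self-delimiting computer $C$ there is a bit string $\pi_C$ (the prefix for $C$) such that for all $p$, $U$ run on the concatenation $\pi_C\,p$ performs the same computation as $C$ run on $p$ (same displayed outputs and same final output, if any). For example, $\pi_C = 0^{g}1$, where $g$ is a Gödel number for $C$. $|p|$ denotes the size in bits of $p$. A formal theory is identified with its set of theorems, a recursively enumerable set of propositions encoded as bit strings. An $N$-bit theory is one whose set of theorems is generated on $U$ by a program of size $N$ bits. A program $q$ is elegant if $U(q)$ is defined and no program $q'$ with $|q'|<|q|$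 satisfies $U(q')=U(q)$. *)

theory Defs
  imports Main
begin

type_synonym bits = "bool list"

text \<open>
  Self-delimiting computers are the programs of a Turing-complete imperative language whose
  variables are stacks of bits (all of them empty at the start, the top of a stack being the head
  of the list). The binary program of such a computer is a separate read-only tape, accessible only
  through the instruction \<open>Read\<close>. There is no instruction that tests for the end of the tape.
\<close>

datatype computer =
    Skip
  | Push bool nat
  | Pop nat
  | Seq computer computer
  | IfTop nat computer computer
  | While nat computer
  | Read nat
  | Display nat
  | Halt nat

text \<open>
  A configuration consists of the instructions still to be executed, the contents of the variables,
  the unread part of the program tape, and the outputs displayed so far, in order.
\<close>

type_synonym config = "computer list \<times> (nat \<Rightarrow> bits) \<times> bits \<times> bits list"

text \<open>
  \<open>IfTop x c d\<close> executes \<open>c\<close> if the top of \<open>x\<close> exists and is 1, and \<open>d\<close> otherwise; \<open>While x c\<close> loops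
  as long as \<open>x\<close> is nonempty. There is no successor in exactly three situations: all instructions
  have been executed (the computation then ends without a final output), \<open>Halt x\<close> is reached (the
  final output is the content of \<open>x\<close>), or a bit is requested beyond the end of the tape.
\<close>

fun step :: "config \<Rightarrow> config option" where
  "step ([], s, t, ys) = None"
| "step (Skip # k, s, t, ys) = Some (k, s, t, ys)"
| "step (Push b x # k, s, t, ys) = Some (k, s(x := b # s x), t, ys)"
| "step (Pop x # k, s, t, ys) = Some (k, s(x := tl (s x)), t, ys)"
| "step (Seq c d # k, s, t, ys) = Some (c # d # k, s, t, ys)"
| "step (IfTop x c d # k, s, t, ys) =
     Some ((if s x \<noteq> [] \<and> hd (s x) then c else d) # k, s, t, ys)"
| "step (While x c # k, s, t, ys) =
     Some (if s x = [] then k else c # While x c # k, s, t, ys)"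
| "step (Read x # k, s, [], ys) = None"
| "step (Read x # k, s, b # t, ys) = Some (k, s(x := b # s x), t, ys)"
| "step (Display x # k, s, t, ys) = Some (k, s, t, ys @ [s x])"
| "step (Halt x # k, s, t, ys) = None"

definition steps :: "config \<Rightarrow> config \<Rightarrow> bool" where
  "steps = (\<lambda>a b. step a = Some b)\<^sup>*\<^sup>*"

definition reaches :: "computer \<Rightarrow> bits \<Rightarrow> config \<Rightarrow> bool" where
  "reaches C p = steps ([C], \<lambda>_. [], p, [])"

text \<open>\<open>halts_with C p x\<close> says that \<open>C(p)\<close> is defined with value \<open>x\<close>.\<close>

definition halts_with :: "computer \<Rightarrow> bits \<Rightarrow> bits \<Rightarrow> bool" where
  "halts_with C p x \<longleftrightarrow> (\<exists>v k s ys. reaches C p (Halt v # k, s, [], ys) \<and> s v = x)"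

definition reads_exactly :: "computer \<Rightarrow> bits \<Rightarrow> bool" where
  "reads_exactly C p \<longleftrightarrow>
     (\<exists>k s ys. reaches C p (k, s, [], ys)) \<and>
     \<not> (\<exists>v k s ys. reaches C p (Read v # k, s, [], ys))"

text \<open>
  \<open>displays C p ys\<close> says that \<open>ys\<close> is a finite initial segment of the possibly infinite sequence of
  outputs displayed by \<open>C\<close> on \<open>p\<close>. The final output of \<open>Halt\<close> is not among the displayed outputs.
\<close>

definition displays :: "computer \<Rightarrow> bits \<Rightarrow> bits list \<Rightarrow> bool" where
  "displays C p ys \<longleftrightarrow> (\<exists>k s t. reaches C p (k, s, t, ys))"

definition generates :: "computer \<Rightarrow> bits \<Rightarrow> bits set \<Rightarrow> bool" where
  "generates C p S \<longleftrightarrow> reads_exactly C p \<and> S = (\<Union>ys \<in> {ys. displays C p ys}. set ys)"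

definition same_computation :: "computer \<Rightarrow> bits \<Rightarrow> computer \<Rightarrow> bits \<Rightarrow> bool" where
  "same_computation C p D q \<longleftrightarrow>
     (\<forall>ys. displays C p ys \<longleftrightarrow> displays D q ys) \<and>
     (\<forall>x. halts_with C p x \<longleftrightarrow> halts_with D q x) \<and>
     (reads_exactly C p \<longleftrightarrow> reads_exactly D q)"

definition universal :: "computer \<Rightarrow> bool" where
  "universal U \<longleftrightarrow> (\<forall>C. \<exists>\<pi>. \<forall>p. same_computation U (\<pi> @ p) C p)"

definition elegant :: "computer \<Rightarrow> bits \<Rightarrow> bool" where
  "elegant U q \<longleftrightarrow>
     (\<exists>x. halts_with U q x \<and> \<not> (\<exists>q'. length q' < length q \<and> halts_with U q' x))"

text \<open>A formal theory is identified with its set of theorems.\<close>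

definition theory_of_size :: "computer \<Rightarrow> nat \<Rightarrow> bits set \<Rightarrow> bool" where
  "theory_of_size U N T \<longleftrightarrow> (\<exists>p. length p = N \<and> generates U p T)"

text \<open>
  Computability of total functions on bit strings: the argument is initially in variable 0 and the
  program tape is empty.
\<close>

definition computable :: "(bits \<Rightarrow> bits) \<Rightarrow> bool" where
  "computable f \<longleftrightarrow>
     (\<exists>C. \<forall>x. \<exists>v k s t ys.
        steps ([C], (\<lambda>_. [])(0 := x), [], []) (Halt v # k, s, t, ys) \<and> s v = f x)"

text \<open>
  \<open>enc q\<close> is the proposition ``\<open>q\<close> is elegant''. As for any Goedel numbering, both directions are
  effective: one can decide whether a string is such a proposition and, if so, recover \<open>q\<close>. The
  leading bit \<open>True\<close> tells successful decoding from failure.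
\<close>

definition effective_encoding :: "(bits \<Rightarrow> bits) \<Rightarrow> bool" where
  "effective_encoding enc \<longleftrightarrow>
     inj enc \<and> computable enc \<and>
     computable (\<lambda>x. if x \<in> range enc then True # inv enc x else [])"

end

theory Submission
  imports Defs
begin

text \<open>
  Chaitin's argument. A computer \<open>C\<close> runs the program \<open>p\<close> of the theory on \<open>U\<close>, counts the bits it
  reads, and as soon as a theorem ``\<open>q\<close> is elegant'' with \<open>q\<close> larger than the count plus \<open>c\<close> is
  displayed, it computes \<open>U(q)\<close> and halts with that value. If \<open>C\<close> finds such a \<open>q\<close>, then \<open>U(q)\<close> is
  produced by a program of about \<open>|p|\<close> bits, so \<open>q\<close> is not elegant. The constant \<open>c\<close> has to exceed
  the overhead of \<open>C\<close> on \<open>U\<close>, which is known only once \<open>C\<close> is; so \<open>C\<close> takes \<open>c = 2k\<close> from a header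
  \<open>1\<^sup>k0\<close> of its program. The total overhead \<open>|\<pi>| + k + 1\<close> is \<open>2k\<close> for \<open>k = |\<pi>| + 1\<close>.

  No interpreter is needed: \<open>C\<close> contains two modified copies of the fixed program text of \<open>U\<close> and one
  of the program that decodes theorems.
\<close>

section \<open>Terminating code fragments\<close>

type_synonym store = "nat \<Rightarrow> bits"

lemma steps_refl: "steps a a"
  by (simp add: steps_def)

lemma steps_trans: "steps a b \<Longrightarrow> steps b c \<Longrightarrow> steps a c"
  by (simp add: steps_def)

lemma steps_step: "step a = Some b \<Longrightarrow> steps b c \<Longrightarrow> steps a c"
  unfolding steps_def by (rule converse_rtranclp_into_rtranclp)

text \<open>Quantifying over the continuation \<open>k\<close>, the tape and the outputs makes these
  facts composable. Tape and outputs return unchanged, so such a fragment is silent.\<close>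

definition runs :: "computer \<Rightarrow> store \<Rightarrow> store \<Rightarrow> bool" where
  "runs c s s' \<longleftrightarrow> (\<forall>k t ys. steps (c # k, s, t, ys) (k, s', t, ys))"

lemma runs_steps: "runs c s s' \<Longrightarrow> steps (k, s', t, ys) a \<Longrightarrow> steps (c # k, s, t, ys) a"
  unfolding runs_def using steps_trans by blast

lemma runs_Skip: "s' = s \<Longrightarrow> runs Skip s s'"
  by (auto simp: runs_def intro: steps_step steps_refl)

lemma runs_Push: "s' = s(x := b # s x) \<Longrightarrow> runs (Push b x) s s'"
  by (auto simp: runs_def intro: steps_step steps_refl)

lemma runs_Pop: "s' = s(x := tl (s x)) \<Longrightarrow> runs (Pop x) s s'"
  by (auto simp: runs_def intro: steps_step steps_refl)

lemma runs_Seq: "runs c s s' \<Longrightarrow> runs d s' s'' \<Longrightarrow> runs (Seq c d) s s''"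
  unfolding runs_def
  by (intro allI, rule steps_step, rule step.simps) (blast intro: steps_trans)

lemma runs_IfTop:
  "runs (if s x \<noteq> [] \<and> hd (s x) then c else d) s s' \<Longrightarrow> runs (IfTop x c d) s s'"
  unfolding runs_def by (intro allI, rule steps_step, rule step.simps) blast

lemma runs_While_done: "s x = [] \<Longrightarrow> runs (While x c) s s"
  by (auto simp: runs_def intro: steps_step steps_refl)

lemma runs_While_loop:
  assumes "s x \<noteq> []" "runs c s s'" "runs (While x c) s' s''"
  shows "runs (While x c) s s''"
  unfolding runs_def
proof (intro allI)
  fix k t ys
  show "steps (While x c # k, s, t, ys) (k, s'', t, ys)"
    by (rule steps_step, rule step.simps)
       (use assms in \<open>auto intro!: runs_steps steps_refl\<close>)
qed

lemmas runs_straight = runs_Skip runs_Push runs_Pop runs_Seq runs_IfTop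

section \<open>Clearing, moving and duplicating stacks\<close>

definition clear :: "nat \<Rightarrow> computer" where
  "clear x = While x (Pop x)"

definition copy_top :: "nat \<Rightarrow> nat \<Rightarrow> computer" where
  "copy_top x y = IfTop x (Push True y) (Push False y)"

definition move :: "nat \<Rightarrow> nat \<Rightarrow> computer" where
  "move x y = While x (Seq (copy_top x y) (Pop x))"

text \<open>Looking below the top of a stack destroys it, so copying while keeping the original
  needs two targets. Both receive the content reversed; a preceding \<open>move\<close> into a
  scratch stack cancels the reversal.\<close>

definition move2 :: "nat \<Rightarrow> nat \<Rightarrow> nat \<Rightarrow> computer" where
  "move2 x y z = While x (Seq (copy_top x y) (Seq (copy_top x z) (Pop x)))"

lemma runs_clear: "runs (clear x) s (s(x := []))"
proof (induction "s x" arbitrary: s)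
  case Nil
  then have "s(x := []) = s" by auto
  with Nil show ?case by (simp add: clear_def runs_While_done)
next
  case (Cons b w)
  have "runs (clear x) (s(x := w)) (s(x := []))"
    using Cons.hyps(1)[of "s(x := w)"] by simp
  then show ?case
    unfolding clear_def
    by (rule runs_While_loop[where s' = "s(x := w)", rotated 2])
       (auto simp flip: Cons.hyps(2) intro!: runs_Pop)
qed

lemma runs_copy_top: "s x = b # w \<Longrightarrow> s' = s(y := b # s y) \<Longrightarrow> runs (copy_top x y) s s'"
  unfolding copy_top_def by (auto intro!: runs_straight)

text \<open>For an empty source the bit pushed is the default \<open>False\<close>. This case occurs
  when \<open>compare_length\<close> runs past the end of a short \<open>tape\<close>.\<close>

lemma runs_copy_top_total:
  "s' = s(y := (s x \<noteq> [] \<and> hd (s x)) # s y) \<Longrightarrow> runs (copy_top x y) s s'"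
  unfolding copy_top_def by (auto intro!: runs_IfTop runs_Push)

lemma runs_move:
  assumes "x \<noteq> y" "s' = s(x := [], y := rev (s x) @ s y)"
  shows "runs (move x y) s s'"
  using assms(2)
proof (induction "s x" arbitrary: s)
  case Nil
  then have "s' = s" by auto
  with Nil show ?case by (simp add: move_def runs_While_done)
next
  case (Cons b w)
  let ?s = "s(x := w, y := b # s y)"
  have "s' = ?s(x := [], y := rev (?s x) @ ?s y)"
    using assms(1) Cons.prems by (auto simp: fun_eq_iff simp flip: Cons.hyps(2))
  then have "runs (move x y) ?s s'"
    using Cons.hyps(1)[of ?s] assms(1) by simp
  moreover have "runs (Seq (copy_top x y) (Pop x)) s ?s"
    using assms(1)
    by (intro runs_Seq[OF runs_copy_top[of s x b w, OF _ refl]] runs_Pop)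
       (auto simp: fun_eq_iff simp flip: Cons.hyps(2))
  ultimately show ?case
    unfolding move_def using Cons.hyps(2) by (auto intro: runs_While_loop[where s' = ?s])
qed

lemma runs_move2:
  assumes "x \<noteq> y" "x \<noteq> z" "y \<noteq> z" "s' = s(x := [], y := rev (s x) @ s y, z := rev (s x) @ s z)"
  shows "runs (move2 x y z) s s'"
  using assms(4)
proof (induction "s x" arbitrary: s)
  case Nil
  then have "s' = s" by auto
  with Nil show ?case by (simp add: move2_def runs_While_done)
next
  case (Cons b w)
  let ?s = "s(x := w, y := b # s y, z := b # s z)"
  have "s' = ?s(x := [], y := rev (?s x) @ ?s y, z := rev (?s x) @ ?s z)"
    using assms(1-3) Cons.prems by (auto simp: fun_eq_iff simp flip: Cons.hyps(2))
  then have "runs (move2 x y z) ?s s'"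
    using Cons.hyps(1)[of ?s] assms(1-3) by simp
  moreover have "runs (Seq (copy_top x y) (Seq (copy_top x z) (Pop x))) s ?s"
    using assms(1-3)
    by (intro runs_Seq[OF runs_copy_top[of s x b w, OF _ refl]]
          runs_Seq[OF runs_copy_top[of _ x b w, OF _ refl]] runs_Pop)
       (auto simp: fun_eq_iff simp flip: Cons.hyps(2))
  ultimately show ?case
    unfolding move2_def using Cons.hyps(2) by (auto intro: runs_While_loop[where s' = ?s])
qed

section \<open>Four disjoint banks of variables\<close>

text \<open>
  The banks belong to the copy of \<open>U\<close> that generates the theory, the copy of \<open>U\<close> that evaluates the
  alleged elegant program, the decoder, and the bookkeeping.
\<close>

definition va :: "nat \<Rightarrow> nat" where "va x = 4 * x"
definition vb :: "nat \<Rightarrow> nat" where "vb x = 4 * x + 1"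
definition vd :: "nat \<Rightarrow> nat" where "vd x = 4 * x + 2"
definition vh :: "nat \<Rightarrow> nat" where "vh x = 4 * x + 3"

definition merge :: "store \<Rightarrow> store \<Rightarrow> store \<Rightarrow> store \<Rightarrow> store" where
  "merge a b d h i =
     (if i mod 4 = 0 then a else if i mod 4 = 1 then b else if i mod 4 = 2 then d else h) (i div 4)"

lemma bank_mod: "va x mod 4 = 0" "vb x mod 4 = 1" "vd x mod 4 = 2" "vh x mod 4 = 3"
  unfolding va_def vb_def vd_def vh_def by presburger+

lemma bank_div: "va x div 4 = x" "vb x div 4 = x" "vd x div 4 = x" "vh x div 4 = x"
  unfolding va_def vb_def vd_def vh_def by presburger+

lemma bank_eq_iff:
  "i = va x \<longleftrightarrow> i mod 4 = 0 \<and> i div 4 = x" "i = vb x \<longleftrightarrow> i mod 4 = 1 \<and> i div 4 = x"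
  "i = vd x \<longleftrightarrow> i mod 4 = 2 \<and> i div 4 = x" "i = vh x \<longleftrightarrow> i mod 4 = 3 \<and> i div 4 = x"
  unfolding va_def vb_def vd_def vh_def by presburger+

lemma merge_apply [simp]:
  "merge a b d h (va x) = a x" "merge a b d h (vb x) = b x"
  "merge a b d h (vd x) = d x" "merge a b d h (vh x) = h x"
  by (simp_all add: merge_def bank_mod bank_div)

lemma merge_update [simp]:
  "(merge a b d h)(va x := w) = merge (a(x := w)) b d h"
  "(merge a b d h)(vb x := w) = merge a (b(x := w)) d h"
  "(merge a b d h)(vd x := w) = merge a b (d(x := w)) h"
  "(merge a b d h)(vh x := w) = merge a b d (h(x := w))"
proof -
  have "i mod 4 = 0 \<or> i mod 4 = 1 \<or> i mod 4 = 2 \<or> i mod 4 = 3" for i :: nat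
    by presburger
  then show
    "(merge a b d h)(va x := w) = merge (a(x := w)) b d h"
    "(merge a b d h)(vb x := w) = merge a (b(x := w)) d h"
    "(merge a b d h)(vd x := w) = merge a b (d(x := w)) h"
    "(merge a b d h)(vh x := w) = merge a b d (h(x := w))"
    by (auto simp: merge_def bank_eq_iff fun_eq_iff)
qed

lemma banks_distinct [simp]:
  "va x \<noteq> vb y" "vb y \<noteq> va x" "va x \<noteq> vd y" "vd y \<noteq> va x" "va x \<noteq> vh y" "vh y \<noteq> va x"
  "vb x \<noteq> vd y" "vd y \<noteq> vb x" "vb x \<noteq> vh y" "vh y \<noteq> vb x" "vd x \<noteq> vh y" "vh y \<noteq> vd x"
  by (auto simp: bank_eq_iff bank_mod)

lemma vh_inject [simp]: "vh x = vh y \<longleftrightarrow> x = y"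
  by (simp add: vh_def)

abbreviation blank :: store where "blank \<equiv> \<lambda>_. []"

lemma merge_blank: "merge blank blank blank blank = blank"
  by (auto simp: merge_def fun_eq_iff)

text \<open>Numbers are unary. \<open>counter\<close> holds the constant from the header plus the
  number of bits read since; \<open>tape\<close> receives the decoded program and then serves as
  simulated program tape.\<close>

abbreviation "counter \<equiv> vh 0"
abbreviation "tmp \<equiv> vh 1"
abbreviation "tape \<equiv> vh 2"
abbreviation "result \<equiv> vh 3"
abbreviation "halted \<equiv> vh 4"
abbreviation "counter_backup \<equiv> vh 5"
abbreviation "tape_backup \<equiv> vh 6"

section \<open>The evaluating copy of the universal computer\<close>

text \<open>\<open>Halt\<close> stays a genuine \<open>Halt\<close>, so the value of the evaluated
  program becomes the final output of the whole computer.\<close>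

primrec evaluator :: "computer \<Rightarrow> computer" where
  "evaluator Skip = Skip"
| "evaluator (Push b x) = Push b (vb x)"
| "evaluator (Pop x) = Pop (vb x)"
| "evaluator (Seq c d) = Seq (evaluator c) (evaluator d)"
| "evaluator (IfTop x c d) = IfTop (vb x) (evaluator c) (evaluator d)"
| "evaluator (While x c) = While (vb x) (evaluator c)"
| "evaluator (Read x) = Seq (copy_top tape (vb x)) (Pop tape)"
| "evaluator (Display x) = Skip"
| "evaluator (Halt x) = Halt (vb x)"

text \<open>The simulated tape lives in \<open>h 2\<close>. Only steps with a successor are
  simulated, so a simulated \<open>Read\<close> always finds a bit there.\<close>

lemma evaluator_step:
  assumes "step (K, s, t, ys) = Some (K', s', t', ys')"
  shows "steps (map evaluator K @ k, merge a s d (h(2 := t)), r, zs)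
               (map evaluator K' @ k, merge a s' d (h(2 := t')), r, zs)"
proof (cases K)
  case Nil
  with assms show ?thesis by simp
next
  case (Cons c L)
  show ?thesis
  proof (cases c)
    case (Read x)
    with assms Cons obtain b where b: "t = b # t'" "s' = s(x := b # s x)" "K' = L"
      by (cases t) auto
    have "runs (evaluator (Read x)) (merge a s d (h(2 := t))) (merge a s' d (h(2 := t')))"
      by (auto simp: b intro!: runs_Seq runs_copy_top[where b = b and w = t'] runs_Pop)
    then show ?thesis
      using Cons Read b by (auto intro: runs_steps steps_refl)
  qed (use assms Cons in \<open>auto intro!: steps_step[OF _ steps_refl]\<close>)
qed

lemma evaluator_steps:
  assumes "steps (K, s, t, ys) (K', s', t', ys')"
  shows "steps (map evaluator K @ k, merge a s d (h(2 := t)), r, zs)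
               (map evaluator K' @ k, merge a s' d (h(2 := t')), r, zs)"
  using assms unfolding steps_def
proof (induction "(K', s', t', ys')" arbitrary: K' s' t' ys' rule: rtranclp_induct)
  case base
  then show ?case by simp
next
  case (step y)
  obtain K1 s1 t1 ys1 where y: "y = (K1, s1, t1, ys1)" by (cases y)
  from step.hyps(3)[OF y] evaluator_step[OF step.hyps(2)[unfolded y]] show ?case
    unfolding steps_def by (rule rtranclp_trans)
qed

text \<open>The real tape \<open>r\<close> is left alone, so evaluating \<open>q\<close> costs no
  further program bits. This is what makes the final program short.\<close>

lemma evaluator_halts:
  assumes "halts_with U q z" "h 2 = q"
  shows "\<exists>v k' S. (\<forall>r zs. steps (evaluator U # k, merge a blank d h, r, zs) (Halt v # k', S, r, zs))
           \<and> S v = z"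
proof -
  from assms(1) obtain v L s ys where
    run: "steps ([U], blank, q, []) (Halt v # L, s, [], ys)" and z: "s v = z"
    unfolding halts_with_def reaches_def by blast
  have "h(2 := q) = h" using assms(2) by auto
  with evaluator_steps[OF run, of k a d h]
  have "steps (evaluator U # k, merge a blank d h, r, zs)
          (Halt (vb v) # map evaluator L @ k, merge a s d (h(2 := [])), r, zs)" for r zs
    by simp
  with z show ?thesis by (metis merge_apply(2))
qed

section \<open>The decoder as a subroutine\<close>

text \<open>Bounds the variables that can become nonempty.\<close>

primrec push_bound :: "computer \<Rightarrow> nat" where
  "push_bound Skip = 0"
| "push_bound (Push b x) = Suc x"
| "push_bound (Pop x) = 0"
| "push_bound (Seq c d) = max (push_bound c) (push_bound d)"
| "push_bound (IfTop x c d) = max (push_bound c) (push_bound d)"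
| "push_bound (While x c) = push_bound c"
| "push_bound (Read x) = 0"
| "push_bound (Display x) = 0"
| "push_bound (Halt x) = 0"

primrec clear_bank :: "nat \<Rightarrow> computer" where
  "clear_bank 0 = Skip"
| "clear_bank (Suc n) = Seq (clear (vd n)) (clear_bank n)"

lemma runs_clear_bank:
  "\<forall>i\<ge>n. d i = [] \<Longrightarrow> runs (clear_bank n) (merge a b d h) (merge a b blank h)"
proof (induction n arbitrary: d)
  case 0
  then have "d = blank" by auto
  then show ?case by (auto intro: runs_Skip)
next
  case (Suc n)
  have "runs (clear (vd n)) (merge a b d h) (merge a b (d(n := [])) h)"
    using runs_clear[of "vd n" "merge a b d h"] by simp
  moreover have "runs (clear_bank n) (merge a b (d(n := [])) h) (merge a b blank h)"
    by (rule Suc.IH) (use Suc.prems not_less_eq_eq order_antisym in \<open>auto simp: fun_upd_def\<close>)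
  ultimately show ?case by (auto intro: runs_Seq)
qed

text \<open>
  A \<open>Halt\<close> nested in loops has to return control to the caller. After it, \<open>halted\<close> disables all
  pushes, and the loops end because all variables of the bank are empty.
\<close>

primrec subroutine :: "nat \<Rightarrow> computer \<Rightarrow> computer" where
  "subroutine m Skip = Skip"
| "subroutine m (Push b x) = IfTop halted Skip (Push b (vd x))"
| "subroutine m (Pop x) = Pop (vd x)"
| "subroutine m (Seq c d) = Seq (subroutine m c) (subroutine m d)"
| "subroutine m (IfTop x c d) = IfTop (vd x) (subroutine m c) (subroutine m d)"
| "subroutine m (While x c) = While (vd x) (subroutine m c)"
| "subroutine m (Read x) = Skip"
| "subroutine m (Display x) = Skip"
| "subroutine m (Halt x) =
     IfTop halted Skip (Seq (move (vd x) result) (Seq (clear_bank m) (Push True halted)))"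

lemma subroutine_halted:
  assumes "h 4 = [True]"
  shows "runs (subroutine m c) (merge a b blank h) (merge a b blank h)"
proof (induction c)
  case (Pop x)
  have "blank(x := []) = blank" by auto
  then show ?case by (auto intro!: runs_Pop)
next
  case (While x c)
  then show ?case by (auto intro!: runs_While_done)
qed (use assms in \<open>auto intro!: runs_straight\<close>)

text \<open>The decoder has an empty program tape, so a \<open>Read\<close> has no successor and its
  translation \<open>Skip\<close> never has to match a step.\<close>

lemma subroutine_step:
  assumes "step (K, s, [], ys) = Some (K', s', t', ys')" "h 4 = []"
  shows "steps (map (subroutine m) K @ k, merge a b s h, r, zs)
               (map (subroutine m) K' @ k, merge a b s' h, r, zs)"
proof (cases K)
  case Nil
  with assms show ?thesis by simp
next
  case (Cons c L)
  show ?thesis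
  proof (cases c)
    case (Push v x)
    have "runs (subroutine m (Push v x)) (merge a b s h) (merge a b (s(x := v # s x)) h)"
      using assms(2) by (auto intro!: runs_straight)
    with assms Cons Push show ?thesis by (auto intro: runs_steps steps_refl)
  qed (use assms Cons in \<open>auto intro!: steps_step[OF _ steps_refl]\<close>)
qed

text \<open>With an empty tape only \<open>Push\<close> lengthens a variable, and every continuation
  consists of subterms of the instructions before it. Hence \<open>Read\<close> may count 0 in
  \<open>push_bound\<close>.\<close>

lemma step_push_bound:
  assumes "step (K, s, [], ys) = Some (K', s', t', ys')"
    and "\<forall>c\<in>set K. push_bound c \<le> m" and "\<forall>i\<ge>m. s i = []"
  shows "t' = [] \<and> (\<forall>c\<in>set K'. push_bound c \<le> m) \<and> (\<forall>i\<ge>m. s' i = [])"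
proof (cases K)
  case Nil
  with assms show ?thesis by simp
next
  case (Cons c L)
  with assms show ?thesis by (cases c) (auto split: if_splits)
qed

lemma subroutine_steps:
  assumes "steps (K, s, [], ys) (K', s', t', ys')" "h 4 = []"
    and "\<forall>c\<in>set K. push_bound c \<le> m" and "\<forall>i\<ge>m. s i = []"
  shows "steps (map (subroutine m) K @ k, merge a b s h, r, zs)
               (map (subroutine m) K' @ k, merge a b s' h, r, zs)
         \<and> t' = [] \<and> (\<forall>c\<in>set K'. push_bound c \<le> m) \<and> (\<forall>i\<ge>m. s' i = [])"
  using assms(1) unfolding steps_def
proof (induction "(K', s', t', ys')" arbitrary: K' s' t' ys' rule: rtranclp_induct)
  case base
  with assms(3,4) show ?case by simp
next
  case (step y)
  obtain K1 s1 t1 ys1 where y: "y = (K1, s1, t1, ys1)" by (cases y)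
  note IH = step.hyps(3)[OF y]
  then have st: "step (K1, s1, [], ys1) = Some (K', s', t', ys')"
    using step.hyps(2) y by simp
  have "steps (map (subroutine m) K1 @ k, merge a b s1 h, r, zs)
          (map (subroutine m) K' @ k, merge a b s' h, r, zs)"
    using subroutine_step[of K1 s1 ys1 K' s' t' ys' h, OF st assms(2)] .
  with IH step_push_bound[OF st] show ?case
    unfolding steps_def by (meson rtranclp_trans)
qed

text \<open>The \<open>Suc\<close> in \<open>m\<close> makes \<open>clear_bank\<close> cover
  variable 0, which holds the argument even if \<open>D\<close> never pushes. The answer is left
  reversed by the \<open>move\<close> into \<open>result\<close>.\<close>

lemma subroutine_runs:
  assumes run: "steps ([D], blank(0 := x), [], []) (Halt v # L, s, t, ys)"
    and m: "m = Suc (push_bound D)" and h: "h 3 = []" "h 4 = []"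
  shows "runs (subroutine m D) (merge a b (blank(0 := x)) h)
           (merge a b blank (h(3 := rev (s v), 4 := [True])))"
  unfolding runs_def
proof (intro allI)
  fix k r zs
  let ?h = "h(3 := rev (s v), 4 := [True])"
  have sim: "steps (map (subroutine m) [D] @ k, merge a b (blank(0 := x)) h, r, zs)
               (map (subroutine m) (Halt v # L) @ k, merge a b s h, r, zs)"
    and fresh: "\<forall>i\<ge>m. s i = []"
    using subroutine_steps[where K = "[D]" and h = h, OF run h(2), of m] m by auto
  have "runs (clear_bank m) (merge a b (s(v := [])) (h(3 := rev (s v))))
          (merge a b blank (h(3 := rev (s v))))"
    using fresh by (intro runs_clear_bank) auto
  then have "runs (subroutine m (Halt v)) (merge a b s h) (merge a b blank ?h)"
    using h by (auto intro!: runs_IfTop runs_Push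
        runs_Seq[OF runs_move[OF _ refl]] runs_Seq[where d = "Push _ _"])
  \<comment> \<open>The instructions \<open>L\<close> still pending behind the simulated
    \<open>Halt\<close> are executed, but each does nothing once the flag is set and the bank is
    empty.\<close>
  moreover have "steps (map (subroutine m) L @ k, merge a b blank ?h, r, zs)
                   (k, merge a b blank ?h, r, zs)"
  proof (induction L)
    case Nil
    then show ?case by (simp add: steps_refl)
  next
    case (Cons c L)
    have "?h 4 = [True]" by simp
    from runs_steps[OF subroutine_halted[of ?h, OF this] Cons.IH] show ?case
      by (simp only: list.map append_Cons)
  qed
  ultimately have "steps (map (subroutine m) (Halt v # L) @ k, merge a b s h, r, zs)
                     (k, merge a b blank ?h, r, zs)"
    by (auto intro: runs_steps)
  with sim show "steps (subroutine m D # k, merge a b (blank(0 := x)) h, r, zs)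
                   (k, merge a b blank ?h, r, zs)"
    by (auto intro: steps_trans)
qed

section \<open>Searching a theory for a large elegant program\<close>

text \<open>The detour through \<open>tmp\<close> gives the decoder a copy of the output and
  restores the original, which the generating computation may use again. The last
  \<open>move\<close> undoes the reversal in \<open>result\<close>.\<close>

definition decode_display :: "nat \<Rightarrow> computer \<Rightarrow> nat \<Rightarrow> computer" where
  "decode_display m D x =
     Seq (move (va x) tmp) (Seq (move2 tmp (va x) (vd 0))
       (Seq (subroutine m D) (Seq (Pop halted) (move result tape))))"

lemma merge_cong:
  "a = a' \<Longrightarrow> b = b' \<Longrightarrow> d = d' \<Longrightarrow> h = h' \<Longrightarrow> merge a b d h = merge a' b' d' h'"
  by simp

lemma merge_ext: "(\<And>i. h i = h' i) \<Longrightarrow> merge a b d h = merge a b d h'"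
  by (intro merge_cong refl ext) simp

lemma runs_decode_display:
  assumes "steps ([D], blank(0 := s x), [], []) (Halt v # L, s', t, ys)"
    and "m = Suc (push_bound D)" and "h 1 = []" "h 2 = []" "h 3 = []" "h 4 = []"
  shows "runs (decode_display m D x) (merge s blank blank h) (merge s blank blank (h(2 := s' v)))"
  unfolding decode_display_def
proof (intro runs_Seq)
  show "runs (move (va x) tmp) (merge s blank blank h)
          (merge (s(x := [])) blank blank (h(1 := rev (s x))))"
    using assms by (intro runs_move) simp_all
  show "runs (move2 tmp (va x) (vd 0)) (merge (s(x := [])) blank blank (h(1 := rev (s x))))
          (merge s blank (blank(0 := s x)) h)"
    using assms by (intro runs_move2) (auto intro!: merge_cong)
  show "runs (subroutine m D) (merge s blank (blank(0 := s x)) h)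
          (merge s blank blank (h(3 := rev (s' v), 4 := [True])))"
    using assms by (intro subroutine_runs)
  show "runs (Pop halted) (merge s blank blank (h(3 := rev (s' v), 4 := [True])))
          (merge s blank blank (h(3 := rev (s' v))))"
    using assms by (intro runs_Pop) (auto intro!: merge_cong)
  show "runs (move result tape) (merge s blank blank (h(3 := rev (s' v))))
          (merge s blank blank (h(2 := s' v)))"
    using assms by (intro runs_move) (auto intro!: merge_cong)
qed

text \<open>One bit is removed per unit of \<open>counter\<close>, so \<open>tape\<close> ends
  nonempty exactly when it was longer than the count. The backups allow both to be rebuilt.\<close>

definition compare_length :: computer where
  "compare_length =
     While counter (Seq (Pop counter) (Seq (Push True counter_backup)
       (Seq (copy_top tape tape_backup) (Pop tape))))"

text \<open>On a short tape, default bits enter the backup, so its content \<open>w\<close> is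
  described only for \<open>n \<le> length (h 2)\<close>. Otherwise it is merely cleared
  later.\<close>

lemma runs_compare_length:
  assumes "h 0 = replicate n True"
  shows "\<exists>w. runs compare_length (merge a b d h)
      (merge a b d (h(0 := [], 2 := drop n (h 2), 5 := replicate n True @ h 5, 6 := w)))
    \<and> (n \<le> length (h 2) \<longrightarrow> w = rev (take n (h 2)) @ h 6)"
  using assms
proof (induction n arbitrary: h)
  case 0
  then have "h(0 := [], 2 := drop 0 (h 2), 5 := replicate 0 True @ h 5, 6 := h 6) = h" by auto
  then show ?case
    using runs_While_done[of "merge a b d h" counter] 0
    by (intro exI[of _ "h 6"]) (simp only: compare_length_def merge_apply, simp)
next
  case (Suc n)
  define e where "e = (h 2 \<noteq> [] \<and> hd (h 2))"
  define h' where "h' = h(0 := replicate n True, 2 := tl (h 2), 5 := True # h 5, 6 := e # h 6)"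
  have "h' 0 = replicate n True" by (simp add: h'_def)
  from Suc.IH[of h', OF this] obtain w where
    w: "runs compare_length (merge a b d h')
         (merge a b d (h'(0 := [], 2 := drop n (h' 2), 5 := replicate n True @ h' 5, 6 := w)))"
    and w_eq: "n \<le> length (h' 2) \<longrightarrow> w = rev (take n (h' 2)) @ h' 6"
    by blast
  have "runs (Seq (Pop counter) (Seq (Push True counter_backup)
          (Seq (copy_top tape tape_backup) (Pop tape)))) (merge a b d h) (merge a b d h')"
    by (intro runs_Seq runs_Pop runs_Push runs_copy_top_total refl)
       (auto simp: e_def h'_def Suc.prems intro!: merge_ext)
  then have "runs compare_length (merge a b d h)
      (merge a b d (h'(0 := [], 2 := drop n (h' 2), 5 := replicate n True @ h' 5, 6 := w)))"
    using w Suc.prems unfolding compare_length_def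
    by (auto intro: runs_While_loop[where s' = "merge a b d h'"])
  moreover have "h'(0 := [], 2 := drop n (h' 2), 5 := replicate n True @ h' 5, 6 := w)
      = h(0 := [], 2 := drop (Suc n) (h 2), 5 := replicate (Suc n) True @ h 5, 6 := w)"
    by (auto simp: h'_def fun_eq_iff drop_Suc simp flip: replicate_app_Cons_same)
  moreover have "Suc n \<le> length (h 2) \<longrightarrow> w = rev (take (Suc n) (h 2)) @ h 6"
    using w_eq by (cases "h 2") (auto simp: h'_def e_def)
  ultimately show ?case by (intro exI[of _ w]) (simp only: simp_thms)
qed

text \<open>The \<open>IfTop\<close> tests the flag bit of successful decoding. The
  \<open>While\<close> acts as a conditional on nonemptiness, which \<open>IfTop\<close> cannot
  express; when \<open>U\<close> halts on the program, the body never returns.\<close>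

definition inspect_display :: "nat \<Rightarrow> computer \<Rightarrow> computer \<Rightarrow> nat \<Rightarrow> computer" where
  "inspect_display m D U x =
     Seq (decode_display m D x)
       (IfTop tape
         (Seq (Pop tape) (Seq (Seq compare_length (move counter_backup counter))
           (Seq (While tape (Seq (move tape_backup tape) (evaluator U))) (clear tape_backup))))
         Skip)"

abbreviation count :: "nat \<Rightarrow> store" where
  "count n \<equiv> blank(0 := replicate n True)"

definition decodes :: "computer \<Rightarrow> (bits \<Rightarrow> bits) \<Rightarrow> bool" where
  "decodes D enc \<longleftrightarrow> (\<forall>x. \<exists>v k s t ys.
     steps ([D], blank(0 := x), [], []) (Halt v # k, s, t, ys) \<and>
     s v = (if x \<in> range enc then True # inv enc x else []))"

lemma inspect_display_decode:
  assumes "decodes D enc" "m = Suc (push_bound D)"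
  shows "runs (decode_display m D x) (merge s blank blank (count n))
    (merge s blank blank ((count n)(2 := if s x \<in> range enc then True # inv enc (s x) else [])))"
proof -
  from assms(1) obtain v k s' t ys where
    "steps ([D], blank(0 := s x), [], []) (Halt v # k, s', t, ys)"
    "s' v = (if s x \<in> range enc then True # inv enc (s x) else [])"
    unfolding decodes_def by blast
  with runs_decode_display[where h = "count n" and s = s and x = x, OF this(1) assms(2)] show ?thesis by simp
qed

lemma inspect_display_compare:
  obtains w where
    "runs (Seq compare_length (move counter_backup counter))
       (merge s blank blank ((count n)(2 := q)))
       (merge s blank blank ((count n)(2 := drop n q, 6 := w)))"
    "n \<le> length q \<Longrightarrow> w = rev (take n q)"
proof -
  let ?h = "(count n)(2 := q)"
  obtain w where
    w: "runs compare_length (merge s blank blank ?h) (merge s blank blank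
         (?h(0 := [], 2 := drop n (?h 2), 5 := replicate n True @ ?h 5, 6 := w)))"
    and w_eq: "n \<le> length (?h 2) \<longrightarrow> w = rev (take n (?h 2)) @ ?h 6"
    using runs_compare_length[of ?h n s blank blank] by auto
  have "runs (move counter_backup counter) (merge s blank blank
         (?h(0 := [], 2 := drop n (?h 2), 5 := replicate n True @ ?h 5, 6 := w)))
        (merge s blank blank ((count n)(2 := drop n q, 6 := w)))"
    by (intro runs_move) (auto intro!: merge_cong)
  from that[OF runs_Seq[OF w this]] w_eq show thesis by simp
qed

text \<open>If decoding fails, the \<open>Skip\<close> branch is taken; if \<open>q\<close> is
  short, nothing remains on \<open>tape\<close> and the loop is skipped. The store must be restored
  completely, as the generation of the theory resumes from it.\<close>

lemma inspect_display_continues: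
  assumes "decodes D enc" "m = Suc (push_bound D)" "inj enc"
    and small: "\<And>q. s x = enc q \<Longrightarrow> length q \<le> n"
  shows "runs (inspect_display m D U x) (merge s blank blank (count n)) (merge s blank blank (count n))"
proof (cases "s x \<in> range enc")
  case False
  then show ?thesis
    using inspect_display_decode[OF assms(1,2), where s = s and x = x and n = n]
    unfolding inspect_display_def
    by (intro runs_Seq) (auto intro!: runs_IfTop runs_Skip merge_ext)
next
  case True
  then obtain q where q: "s x = enc q" by blast
  with assms(3) have inv: "inv enc (s x) = q" by simp
  let ?h = "(count n)(2 := True # q)"
  obtain w where w: "runs (Seq compare_length (move counter_backup counter))
       (merge s blank blank ((count n)(2 := q)))
       (merge s blank blank ((count n)(2 := drop n q, 6 := w)))"
    using inspect_display_compare[of s n q] by blast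
  have empty_tape: "drop n q = []" using small[OF q] by simp
  let ?L = "While tape (Seq (move tape_backup tape) (evaluator U))"
  let ?g = "(count n)(2 := drop n q, 6 := w)"
  have "runs (decode_display m D x) (merge s blank blank (count n)) (merge s blank blank ?h)"
    using inspect_display_decode[OF assms(1,2), where s = s and x = x and n = n] True inv by simp
  moreover have "runs (Pop tape) (merge s blank blank ?h) (merge s blank blank ((count n)(2 := q)))"
    by (intro runs_Pop) (auto intro!: merge_cong)
  moreover have "runs ?L (merge s blank blank ?g) (merge s blank blank ?g)"
    using empty_tape by (intro runs_While_done) simp
  moreover have "runs (clear tape_backup) (merge s blank blank ?g) (merge s blank blank (count n))"
  proof -
    have "?g(6 := []) = count n" using empty_tape by (auto simp: fun_eq_iff)
    then show ?thesis using runs_clear[of tape_backup "merge s blank blank ?g"]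
      by (simp only: merge_update)
  qed
  ultimately show ?thesis
    unfolding inspect_display_def
    by (intro runs_Seq runs_IfTop) (auto intro: runs_Seq w)
qed

lemma inspect_display_halts:
  assumes "decodes D enc" "m = Suc (push_bound D)" "inj enc"
    and q: "s x = enc q" and large: "length q > n" and z: "halts_with U q z"
  shows "\<exists>v k' S. steps (inspect_display m D U x # k, merge s blank blank (count n), [], [])
           (Halt v # k', S, [], []) \<and> S v = z"
proof -
  have inv: "inv enc (s x) = q" using q assms(3) by simp
  let ?h = "(count n)(2 := True # q)"
  obtain w where w: "runs (Seq compare_length (move counter_backup counter))
       (merge s blank blank ((count n)(2 := q)))
       (merge s blank blank ((count n)(2 := drop n q, 6 := w)))"
    and w_eq: "n \<le> length q \<Longrightarrow> w = rev (take n q)"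
    using inspect_display_compare[of s n q] by blast
  let ?body = "Seq (move tape_backup tape) (evaluator U)"
  let ?k = "While tape ?body # clear tape_backup # k"
  let ?g = "(count n)(2 := drop n q, 6 := w)"
  have decode: "runs (decode_display m D x) (merge s blank blank (count n)) (merge s blank blank ?h)"
    using inspect_display_decode[OF assms(1,2), where s = s and x = x and n = n] q inv by simp
  have pop: "runs (Pop tape) (merge s blank blank ?h) (merge s blank blank ((count n)(2 := q)))"
    by (intro runs_Pop) (auto intro!: merge_cong)
  \<comment> \<open>The backup holds the first \<open>n\<close> bits reversed; moving them back in
    front of \<open>drop n q\<close> yields \<open>q\<close>.\<close>
  have restore: "runs (move tape_backup tape) (merge s blank blank ?g)
                   (merge s blank blank ((count n)(2 := q)))"
    using w_eq large by (intro runs_move) (auto intro!: merge_cong)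
  have "((count n)(2 := q)) 2 = q" by simp
  from evaluator_halts[where h = "(count n)(2 := q)", OF z this, of ?k s blank] obtain v k' S where
    run: "steps (evaluator U # ?k, merge s blank blank ((count n)(2 := q)), [], []) (Halt v # k', S, [], [])"
    and v: "S v = z"
    by blast
  \<comment> \<open>This branch ends in \<open>Halt\<close> and gives no \<open>runs\<close> fact,
    so the halting run is extended backwards, one enclosing instruction at a time.\<close>
  from runs_steps[OF restore run]
  have "steps (move tape_backup tape # evaluator U # ?k, merge s blank blank ?g, [], [])
          (Halt v # k', S, [], [])" .
  then have "steps (?body # ?k, merge s blank blank ?g, [], []) (Halt v # k', S, [], [])"
    by (rule steps_step[rotated]) simp
  then have "steps (?k, merge s blank blank ?g, [], []) (Halt v # k', S, [], [])"
    by (rule steps_step[rotated]) (use large in simp)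
  then have "steps (Seq (While tape ?body) (clear tape_backup) # k, merge s blank blank ?g, [], [])
               (Halt v # k', S, [], [])"
    by (rule steps_step[rotated]) simp
  from steps_step[OF step.simps(5) runs_steps[OF pop steps_step[OF step.simps(5) runs_steps[OF w this]]]]
  have "steps (Seq (Pop tape) (Seq (Seq compare_length (move counter_backup counter))
           (Seq (While tape ?body) (clear tape_backup))) # k, merge s blank blank ?h, [], [])
          (Halt v # k', S, [], [])" .
  then have "steps (IfTop tape (Seq (Pop tape) (Seq (Seq compare_length (move counter_backup counter))
           (Seq (While tape ?body) (clear tape_backup)))) Skip # k, merge s blank blank ?h, [], [])
          (Halt v # k', S, [], [])"
    by (rule steps_step[rotated]) simp
  from steps_step[OF step.simps(5) runs_steps[OF decode this]] v show ?thesis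
    unfolding inspect_display_def by blast
qed

section \<open>The generating copy of the universal computer\<close>

primrec generator :: "(nat \<Rightarrow> computer) \<Rightarrow> computer \<Rightarrow> computer" where
  "generator H Skip = Skip"
| "generator H (Push b x) = Push b (va x)"
| "generator H (Pop x) = Pop (va x)"
| "generator H (Seq c d) = Seq (generator H c) (generator H d)"
| "generator H (IfTop x c d) = IfTop (va x) (generator H c) (generator H d)"
| "generator H (While x c) = While (va x) (generator H c)"
| "generator H (Read x) = Seq (Read (va x)) (Push True counter)"
| "generator H (Display x) = H x"
| "generator H (Halt x) = Skip"

text \<open>A step depends only on the bits \<open>u\<close> that it consumes, so the unread rest
  may be replaced by any \<open>r\<close>. This later permits cutting the tape off right after the
  bits already read.\<close>

lemma generator_step:
  assumes st: "step (K, s, t, ys) = Some (K', s', t', ys')"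
    and disp: "\<And>x L. K = Display x # L \<Longrightarrow>
      runs (H x) (merge s blank blank (count n)) (merge s blank blank (count n))"
  shows "\<exists>u. t = u @ t' \<and> (\<forall>r. steps (map (generator H) K, merge s blank blank (count n), u @ r, [])
     (map (generator H) K', merge s' blank blank (count (n + length u)), r, []))"
proof (cases K)
  case Nil
  with st show ?thesis by simp
next
  case (Cons c L)
  show ?thesis
  proof (cases c)
    case (Read x)
    with st Cons obtain b where b: "t = b # t'" "s' = s(x := b # s x)" "K' = L"
      by (cases t) auto
    have "runs (Push True counter) (merge s' blank blank (count n))
            (merge s' blank blank (count (n + length [b])))"
      by (intro runs_Push) (auto intro!: merge_cong)
    then have "steps (map (generator H) K, merge s blank blank (count n), [b] @ r, [])
        (map (generator H) K', merge s' blank blank (count (n + length [b])), r, [])" for r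
      unfolding Cons Read b(3) list.map generator.simps append_Cons append_Nil
      by (intro steps_step[OF step.simps(5)] steps_step[OF step.simps(9)] runs_steps[OF _ steps_refl])
         (simp add: b)
    then show ?thesis using b by (intro exI[of _ "[b]"]) simp
  next
    case (Display x)
    with st Cons have "K' = L" "s' = s" "t' = t" by auto
    then show ?thesis
      using runs_steps[OF disp[unfolded Cons Display, OF refl] steps_refl] Cons Display
      by (intro exI[of _ "[]"]) simp
  qed (use st Cons in \<open>auto intro!: exI[of _ "[]"] steps_step[OF _ steps_refl]\<close>)
qed

definition halts_from :: "config \<Rightarrow> bits \<Rightarrow> bool" where
  "halts_from a z \<longleftrightarrow> (\<exists>v k s ys. steps a (Halt v # k, s, [], ys) \<and> s v = z)"

lemma steps_halts_from: "steps a b \<Longrightarrow> halts_from b z \<Longrightarrow> halts_from a z"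
  unfolding halts_from_def by (blast intro: steps_trans)

text \<open>
  If a large program is called elegant after \<open>C\<close> has read only a part \<open>u\<close> of \<open>p\<close>, then \<open>C\<close> halts on
  \<open>u\<close> already.
\<close>

lemma generator_steps:
  assumes "decodes D enc" "m = Suc (push_bound D)" "inj enc"
    and G: "G = generator (inspect_display m D U)"
    and run: "steps ([U], blank, p, []) (K, s, t, ys)"
  shows "(\<exists>u q ys. displays U p ys \<and> enc q \<in> set ys \<and> length q > n + length u \<and>
            (\<forall>z. halts_with U q z \<longrightarrow> halts_from ([G U], merge blank blank blank (count n), u, []) z)) \<or>
         (\<exists>u. p = u @ t \<and> (\<forall>r. steps ([G U], merge blank blank blank (count n), u @ r, [])
            (map G K, merge s blank blank (count (n + length u)), r, [])) \<and>
            (\<forall>q. enc q \<in> set ys \<longrightarrow> length q \<le> n + length u))" (is "?found \<or> _")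
  using run unfolding steps_def
proof (induction "(K, s, t, ys)" arbitrary: K s t ys rule: rtranclp_induct)
  case base
  then show ?case by simp
next
  case (step a)
  obtain K1 s1 t1 ys1 where a: "a = (K1, s1, t1, ys1)" by (cases a)
  have st: "step (K1, s1, t1, ys1) = Some (K, s, t, ys)" using step.hyps(2) a by simp
  show ?case
  proof (cases ?found)
    case True
    then show ?thesis by blast
  next
    case False
    with step.hyps(3)[OF a] obtain u where p: "p = u @ t1"
      and sim: "\<And>r. steps ([G U], merge blank blank blank (count n), u @ r, [])
            (map G K1, merge s1 blank blank (count (n + length u)), r, [])"
      and old: "\<And>q. enc q \<in> set ys1 \<Longrightarrow> length q \<le> n + length u"
      unfolding steps_def by blast
    \<comment> \<open>A large program displayed now would make the copy halt on \<open>u\<close>,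
      which is the excluded first alternative.\<close>
    have small: "length q \<le> n + length u" if K1: "K1 = Display x # L" and q: "s1 x = enc q" for x L q
    proof (rule ccontr)
      assume "\<not> ?thesis"
      then have large: "length q > n + length u" by simp
      have ys: "ys = ys1 @ [enc q]" using st K1 q by simp
      have "displays U p ys"
        using step.hyps(1,2) unfolding displays_def reaches_def steps_def
        by (meson rtranclp.rtrancl_into_rtrancl)
      moreover have "halts_from ([G U], merge blank blank blank (count n), u, []) z"
        if "halts_with U q z" for z
      proof (rule steps_halts_from)
        \<comment> \<open>Taking \<open>r\<close> empty ends the tape after \<open>u\<close>, so the
          halt occurs with everything read, as \<open>halts_from\<close> demands.\<close>
        show "steps ([G U], merge blank blank blank (count n), u, [])
                (map G K1, merge s1 blank blank (count (n + length u)), [], [])"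
          using sim[of "[]"] by simp
        show "halts_from (map G K1, merge s1 blank blank (count (n + length u)), [], []) z"
          using inspect_display_halts[where s = s1 and x = x and k = "map G L", OF assms(1-3) q large that]
          unfolding halts_from_def K1 by (auto simp: G)
      qed
      ultimately have ?found using large ys by fastforce
      with False show False ..
    qed
    have "\<exists>w. t1 = w @ t \<and> (\<forall>r. steps (map G K1, merge s1 blank blank (count (n + length u)), w @ r, [])
            (map G K, merge s blank blank (count (n + length u + length w)), r, []))"
      unfolding G
    proof (rule generator_step[OF st])
      fix x L
      assume "K1 = Display x # L"
      then show "runs (inspect_display m D U x) (merge s1 blank blank (count (n + length u)))
                   (merge s1 blank blank (count (n + length u)))"
        by (intro inspect_display_continues[OF assms(1-3)] small)
    qed
    then obtain w where t1: "t1 = w @ t"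
      and next_step: "\<And>r. steps (map G K1, merge s1 blank blank (count (n + length u)), w @ r, [])
            (map G K, merge s blank blank (count (n + length u + length w)), r, [])"
      by blast
    have "steps ([G U], merge blank blank blank (count n), (u @ w) @ r, [])
            (map G K, merge s blank blank (count (n + length (u @ w))), r, [])" for r
      using steps_trans[OF sim[of "w @ r"] next_step[of r]] by (simp add: add.assoc)
    moreover have "length q \<le> n + length (u @ w)" if "enc q \<in> set ys" for q
    proof (cases "enc q \<in> set ys1")
      case True
      with old show ?thesis by fastforce
    next
      case False
      \<comment> \<open>Only \<open>Display\<close> extends the outputs, so a new theorem is the one
        displayed in this step.\<close>
      then have "\<exists>x L. K1 = Display x # L \<and> s1 x = enc q"
        using st that
        by (cases "(K1, s1, t1, ys1)" rule: step.cases) (auto split: if_splits)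
      with small show ?thesis by fastforce
    qed
    ultimately show ?thesis using p t1 unfolding steps_def by fastforce
  qed
qed

section \<open>The self-delimiting header that supplies the constant\<close>

definition read_header :: computer where
  "read_header = Seq (Push True tmp) (While tmp (Seq (Read result)
     (Seq (IfTop result (Seq (Push True counter) (Push True counter)) (Pop tmp)) (Pop result))))"

text \<open>Each 1 of the header adds two units to \<open>counter\<close>; the first 0 empties the
  loop flag \<open>tmp\<close>.\<close>

lemma read_header_steps:
  "steps (read_header # k, blank, replicate i True @ False # r, ys)
     (k, merge blank blank blank (count (2 * i)), r, ys)"
proof -
  let ?H = "Seq (IfTop result (Seq (Push True counter) (Push True counter)) (Pop tmp)) (Pop result)"
  let ?B = "Seq (Read result) ?H"
  let ?s = "\<lambda>j. merge blank blank blank ((count j)(1 := [True]))"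
  \<comment> \<open>The count \<open>j\<close> accumulated so far is generalized for the induction
    on the header length.\<close>
  have "steps (While tmp ?B # k, ?s j, replicate i True @ False # r, ys)
          (k, merge blank blank blank (count (j + 2 * i)), r, ys)" for j
  proof (induction i arbitrary: j)
    case 0
    have "runs ?H ((?s j)(result := False # ?s j result)) (merge blank blank blank (count j))"
      by (rule runs_Seq[where s' = "merge blank blank blank ((count j)(3 := [False]))"])
         (auto intro!: runs_straight merge_ext)
    moreover have "steps (While tmp ?B # k, merge blank blank blank (count j), r, ys)
                     (k, merge blank blank blank (count j), r, ys)"
      by (rule runs_steps[OF runs_While_done steps_refl]) simp
    ultimately have "steps (?H # While tmp ?B # k, (?s j)(result := False # ?s j result), r, ys)
                       (k, merge blank blank blank (count j), r, ys)"
      by (rule runs_steps)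
    then have "steps (Read result # ?H # While tmp ?B # k, ?s j, False # r, ys)
                 (k, merge blank blank blank (count j), r, ys)"
      by (rule steps_step[OF step.simps(9)])
    then have "steps (?B # While tmp ?B # k, ?s j, False # r, ys)
                 (k, merge blank blank blank (count j), r, ys)"
      by (rule steps_step[OF step.simps(5)])
    then have "steps (While tmp ?B # k, ?s j, False # r, ys)
                 (k, merge blank blank blank (count j), r, ys)"
      by (rule steps_step[rotated]) simp
    then show ?case by (simp only: replicate_0 append_Nil mult_0_right add_0_right)
  next
    case (Suc i)
    let ?t = "replicate i True @ False # r"
    have "runs ?H ((?s j)(result := True # ?s j result)) (?s (j + 2))"
      by (rule runs_Seq[where s' = "merge blank blank blank ((count (j + 2))(1 := [True], 3 := [True]))"])
         (auto intro!: runs_IfTop runs_Seq[OF runs_Push[OF refl] runs_Push] runs_Pop merge_ext)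
    from runs_steps[OF this Suc.IH]
    have "steps (?H # While tmp ?B # k, (?s j)(result := True # ?s j result), ?t, ys)
            (k, merge blank blank blank (count (j + 2 + 2 * i)), r, ys)" .
    then have "steps (Read result # ?H # While tmp ?B # k, ?s j, True # ?t, ys)
                 (k, merge blank blank blank (count (j + 2 + 2 * i)), r, ys)"
      by (rule steps_step[OF step.simps(9)])
    then have "steps (?B # While tmp ?B # k, ?s j, True # ?t, ys)
                 (k, merge blank blank blank (count (j + 2 + 2 * i)), r, ys)"
      by (rule steps_step[OF step.simps(5)])
    then have "steps (While tmp ?B # k, ?s j, True # ?t, ys)
                 (k, merge blank blank blank (count (j + 2 + 2 * i)), r, ys)"
      by (rule steps_step[rotated]) simp
    then show ?case by (simp only: replicate_Suc append_Cons mult_Suc_right add.assoc)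
  qed
  from this[of 0] have loop: "steps (While tmp ?B # k, ?s 0, replicate i True @ False # r, ys)
      (k, merge blank blank blank (count (2 * i)), r, ys)"
    by simp
  have "runs (Push True tmp) blank (?s 0)"
  proof (rule runs_Push)
    have "(merge blank blank blank blank)(tmp := [True]) = ?s 0"
      by (auto intro!: merge_cong)
    then show "?s 0 = blank(tmp := True # blank tmp)"
      by (simp only: merge_blank)
  qed
  from runs_steps[OF this loop] show ?thesis
    unfolding read_header_def by (rule steps_step[OF step.simps(5)])
qed

section \<open>The contradiction with elegance\<close>

theorem mainTheorem1:
  fixes U :: computer and enc :: "bits \<Rightarrow> bits"
  assumes "universal U" and "effective_encoding enc"
  shows "\<exists>c :: nat. \<forall>(N :: nat) (T :: bits set).
    theory_of_size U N T \<longrightarrow>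
    (\<forall>q. enc q \<in> T \<longrightarrow> elegant U q) \<longrightarrow>
    \<not> (\<exists>q. enc q \<in> T \<and> length q > N + c)"
proof -
  from assms(2) obtain D where D: "decodes D enc" and inj: "inj enc"
    unfolding effective_encoding_def computable_def decodes_def by blast
  define m where "m = Suc (push_bound D)"
  define G where "G = generator (inspect_display m D U)"
  define C where "C = Seq read_header (G U)"
  obtain \<pi> where \<pi>: "\<And>p. same_computation U (\<pi> @ p) C p"
    using assms(1) unfolding universal_def by blast
  \<comment> \<open>There is no circularity: \<open>C\<close> takes the constant from its input, so
    \<open>\<pi>\<close> is fixed before \<open>k\<close> is chosen.\<close>
  define k where "k = Suc (length \<pi>)"
  have shortcut: "halts_with U (\<pi> @ replicate k True @ False # u) z"
    if "halts_from ([G U], merge blank blank blank (count (2 * k)), u, []) z" for u z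
  proof -
    have "steps ([C], blank, replicate k True @ False # u, [])
            ([G U], merge blank blank blank (count (2 * k)), u, [])"
      unfolding C_def by (rule steps_step[OF step.simps(5) read_header_steps])
    from steps_halts_from[OF this that] have "halts_with C (replicate k True @ False # u) z"
      unfolding halts_from_def halts_with_def reaches_def by simp
    with \<pi> show ?thesis unfolding same_computation_def by blast
  qed
  have False if "generates U p T" and sound: "\<forall>q. enc q \<in> T \<longrightarrow> elegant U q"
    and q: "enc q \<in> T" and large: "length q > length p + 2 * k" for p T q
  proof -
    have T: "T = (\<Union>ys\<in>{ys. displays U p ys}. set ys)"
      using that(1) unfolding generates_def by blast
    with q obtain ys K s t where ys: "enc q \<in> set ys"
      and run: "steps ([U], blank, p, []) (K, s, t, ys)"
      unfolding displays_def reaches_def by blast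
    \<comment> \<open>Since \<open>u\<close> is a prefix of \<open>p\<close>, the second alternative
      of \<open>generator_steps\<close> would bound \<open>length q\<close> by
      \<open>2 * k + length p\<close>. The program \<open>q'\<close> found instead may differ from
      \<open>q\<close>.\<close>
    have "\<not> (\<exists>u. p = u @ t \<and> (\<forall>q. enc q \<in> set ys \<longrightarrow> length q \<le> 2 * k + length u))"
      using ys large by force
    with generator_steps[OF D m_def inj G_def run, of "2 * k"] obtain u q' where
      q': "enc q' \<in> T" "length q' > 2 * k + length u"
      and fast: "\<And>z. halts_with U q' z \<Longrightarrow>
        halts_from ([G U], merge blank blank blank (count (2 * k)), u, []) z"
      unfolding T by blast
    from sound q'(1) obtain z where z: "halts_with U q' z"
      and least: "\<not> (\<exists>r. length r < length q' \<and> halts_with U r z)"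
      unfolding elegant_def by blast
    \<comment> \<open>The left side equals \<open>length \<pi> + k + 1 + length u\<close>, which is
      \<open>2 * k + length u\<close> by the choice of \<open>k\<close>.\<close>
    have "length (\<pi> @ replicate k True @ False # u) < length q'"
      using q'(2) by (simp add: k_def)
    with shortcut[OF fast[OF z]] least show False by blast
  qed
  then show ?thesis
    unfolding theory_of_size_def by (intro exI[of _ "2 * k"]) blast
qed

end
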